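(* Let $G=H_1\bigtriangledown H_2$, where $H_1$ and $H_2$ are $r$-regular graphs of order $n_1$ and $n_2$, respectively. If $\min\{n_1,n_2\}\geq 2r$, then $G$ is a $Q$-exact graph.
   Context: All graphs are finite, simple and unweighted. The join $H_1\bigtriangledown H_2$ of two graphs on disjoint vertex sets is obtained from their disjoint union by adding all edges $uv$ with $u\in V(H_1)$, $v\in V(H_2)$. For a graph $G=(V,E)$ on $n$ vertices, $A(G)$ is the adjacency matrix, $D(G)$ the diagonal degree matrix, $Q(G)=D(G)+A(G)$, and $q_n(G)$ is the smallest eigenvalue of $Q(G)$; $W=|E|$; $mcut(G)$ is the maximum over $X\subseteq V$ of the number of edges with exactly one endpoint in $X$. $G$ is $Q$-exact if $q_n(G)=\frac{4}{n}(W-mcut(G))$. *)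

theory Defs
  imports "Jordan_Normal_Form.Spectral_Radius"
begin

record 'a graph =
  verts :: "'a set"
  edges :: "'a set set"

definition simple_graph :: "'a graph \<Rightarrow> bool" where
  "simple_graph G \<longleftrightarrow> finite (verts G) \<and>
     edges G \<subseteq> {{u, v} | u v. u \<in> verts G \<and> v \<in> verts G \<and> u \<noteq> v}"

definition graph_order :: "'a graph \<Rightarrow> nat" where
  "graph_order G = card (verts G)"

definition vertex_degree :: "'a graph \<Rightarrow> 'a \<Rightarrow> nat" where
  "vertex_degree G v = card {e \<in> edges G. v \<in> e}"

definition regular :: "nat \<Rightarrow> 'a graph \<Rightarrow> bool" where
  "regular r G \<longleftrightarrow> (\<forall>v \<in> verts G. vertex_degree G v = r)"

text \<open>Only meaningful when the two vertex sets are disjoint.\<close>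

definition graph_join :: "'a graph \<Rightarrow> 'a graph \<Rightarrow> 'a graph" (infixl "\<nabla>" 65) where
  "H1 \<nabla> H2 =
     \<lparr> verts = verts H1 \<union> verts H2,
       edges = edges H1 \<union> edges H2 \<union> {{u, v} | u v. u \<in> verts H1 \<and> v \<in> verts H2} \<rparr>"

text \<open>
  Matrices are indexed by \<open>{0..<n}\<close>, so they are taken with respect to a list \<open>vs\<close>
  enumerating the vertices.
\<close>

definition enumerates :: "'a list \<Rightarrow> 'a graph \<Rightarrow> bool" where
  "enumerates vs G \<longleftrightarrow> distinct vs \<and> set vs = verts G"

definition adjacency_mat :: "'a graph \<Rightarrow> 'a list \<Rightarrow> real mat" where
  "adjacency_mat G vs = mat (length vs) (length vs)
     (\<lambda>(i, j). if {vs ! i, vs ! j} \<in> edges G then 1 else 0)"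

definition degree_mat :: "'a graph \<Rightarrow> 'a list \<Rightarrow> real mat" where
  "degree_mat G vs = mat_diag (length vs) (\<lambda>i. real (vertex_degree G (vs ! i)))"

definition Q_mat :: "'a graph \<Rightarrow> 'a list \<Rightarrow> real mat" where
  "Q_mat G vs = degree_mat G vs + adjacency_mat G vs"

text \<open>
  The choice of the enumeration is immaterial, see \<open>q_min_eq\<close> below. The matrix is real
  symmetric, so its real spectrum consists of all its eigenvalues.
\<close>

definition q_min :: "'a graph \<Rightarrow> real" where
  "q_min G = Min (spectrum (Q_mat G (SOME vs. enumerates vs G)))"

definition mcut :: "'a graph \<Rightarrow> nat" where
  "mcut G = Max ((\<lambda>X. card {e \<in> edges G. card (e \<inter> X) = 1}) ` Pow (verts G))"

definition Q_exact :: "'a graph \<Rightarrow> bool" where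
  "Q_exact G \<longleftrightarrow>
     q_min G = 4 / real (graph_order G) * (real (card (edges G)) - real (mcut G))"

lemma Q_mat_mult_vec:
  assumes en: "enumerates vs G" and x: "x \<in> carrier_vec (length vs)" and i: "i < length vs"
    and f: "\<And>i. i < length vs \<Longrightarrow> f (vs ! i) = x $ i"
  shows "(Q_mat G vs *\<^sub>v x) $ i =
    real (vertex_degree G (vs ! i)) * f (vs ! i) +
      (\<Sum>v\<in>verts G. (if {vs ! i, v} \<in> edges G then 1 else 0) * f v)"
proof -
  have b: "bij_betw (\<lambda>j. vs ! j) {0..<length vs} (verts G)"
    using en bij_betw_nth[of vs "{0..<length vs}" "verts G"]
    unfolding enumerates_def by (auto simp: atLeast0LessThan)
  have "(Q_mat G vs *\<^sub>v x) $ i =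
    (\<Sum>j = 0..<length vs. ((if i = j then real (vertex_degree G (vs ! j)) else 0) +
        (if {vs ! i, vs ! j} \<in> edges G then 1 else 0)) * x $ j)"
    using x i by (auto simp: Q_mat_def degree_mat_def adjacency_mat_def mat_diag_def
        scalar_prod_def intro!: sum.cong)
  also have "\<dots> = (\<Sum>j = 0..<length vs. (if i = j then real (vertex_degree G (vs ! j)) * x $ j else 0)) +
    (\<Sum>j = 0..<length vs. (if {vs ! i, vs ! j} \<in> edges G then 1 else 0) * x $ j)"
    by (simp only: sum.distrib[symmetric], rule sum.cong) (auto simp: algebra_simps)
  also have "(\<Sum>j = 0..<length vs. (if i = j then real (vertex_degree G (vs ! j)) * x $ j else 0)) =
    real (vertex_degree G (vs ! i)) * f (vs ! i)"
    using i f by (simp add: sum.delta)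
  also have "(\<Sum>j = 0..<length vs. (if {vs ! i, vs ! j} \<in> edges G then 1 else 0) * x $ j) =
    (\<Sum>j = 0..<length vs. (if {vs ! i, vs ! j} \<in> edges G then 1 else 0) * f (vs ! j))"
    using f by (intro sum.cong) auto
  also have "\<dots> = (\<Sum>v\<in>verts G. (if {vs ! i, v} \<in> edges G then 1 else 0) * f v)"
    by (rule sum.reindex_bij_betw[OF b])
  finally show ?thesis .
qed

lemma eigenvalue_Q_mat_iff:
  assumes en: "enumerates vs G"
  shows "eigenvalue (Q_mat G vs) k \<longleftrightarrow>
    (\<exists>f. (\<exists>v\<in>verts G. f v \<noteq> 0) \<and> (\<forall>u\<in>verts G.
       real (vertex_degree G u) * f u + (\<Sum>v\<in>verts G. (if {u, v} \<in> edges G then 1 else 0) * f v)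
         = k * f u))"
    (is "?L \<longleftrightarrow> ?R")
proof
  have V: "verts G = (\<lambda>i. vs ! i) ` {..<length vs}" and d: "distinct vs"
    using en unfolding enumerates_def by (force simp: in_set_conv_nth)+
  have dim: "dim_row (Q_mat G vs) = length vs"
    by (simp add: Q_mat_def adjacency_mat_def)
  {
    assume ?L
    then obtain x where x: "x \<in> carrier_vec (length vs)" "x \<noteq> 0\<^sub>v (length vs)"
      and eq: "Q_mat G vs *\<^sub>v x = k \<cdot>\<^sub>v x"
      unfolding eigenvalue_def eigenvector_def dim by auto
    define f where "f v = x $ (THE i. i < length vs \<and> vs ! i = v)" for v
    have f: "f (vs ! i) = x $ i" if "i < length vs" for i
    proof -
      have "(THE j. j < length vs \<and> vs ! j = vs ! i) = i"
        using that d by (intro the_equality) (auto simp: nth_eq_iff_index_eq)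
      then show ?thesis unfolding f_def by simp
    qed
    obtain i where "i < length vs" "x $ i \<noteq> 0"
      using x by (metis carrier_vecD eq_vecI index_zero_vec(1,2))
    then have "\<exists>v\<in>verts G. f v \<noteq> 0" using f V by auto
    moreover have "real (vertex_degree G (vs ! i)) * f (vs ! i) +
        (\<Sum>v\<in>verts G. (if {vs ! i, v} \<in> edges G then 1 else 0) * f v) = k * f (vs ! i)"
      if i: "i < length vs" for i
      using Q_mat_mult_vec[OF en x(1) i f] x i f[OF i] unfolding eq by simp
    ultimately show ?R using V by (intro exI[of _ f]) auto
  }
  {
    assume ?R
    then obtain f where nz: "\<exists>v\<in>verts G. f v \<noteq> 0" and eq: "\<And>u. u \<in> verts G \<Longrightarrow>
       real (vertex_degree G u) * f u + (\<Sum>v\<in>verts G. (if {u, v} \<in> edges G then 1 else 0) * f v)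
         = k * f u" by auto
    define x where "x = vec (length vs) (\<lambda>i. f (vs ! i))"
    have x: "x \<in> carrier_vec (length vs)" and f: "\<And>i. i < length vs \<Longrightarrow> f (vs ! i) = x $ i"
      by (auto simp: x_def)
    from nz V obtain i where i: "i < length vs" "x $ i \<noteq> 0" using f by auto
    then have "x \<noteq> 0\<^sub>v (length vs)" by auto
    moreover have "Q_mat G vs *\<^sub>v x = k \<cdot>\<^sub>v x"
    proof (rule eq_vecI)
      fix i assume "i < dim_vec (k \<cdot>\<^sub>v x)"
      then have i: "i < length vs" using x by simp
      then have "vs ! i \<in> verts G" using V by auto
      then show "(Q_mat G vs *\<^sub>v x) $ i = (k \<cdot>\<^sub>v x) $ i"
        using Q_mat_mult_vec[OF en x i f] eq[of "vs ! i"] x i f[OF i] by simp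
    qed (use x dim in auto)
    ultimately show ?L using x unfolding eigenvalue_def eigenvector_def dim by auto
  }
qed

lemma q_min_eq:
  assumes "enumerates vs G"
  shows "q_min G = Min (spectrum (Q_mat G vs))"
proof -
  have "enumerates (SOME vs. enumerates vs G) G"
    using assms by (rule someI)
  then have "eigenvalue (Q_mat G (SOME vs. enumerates vs G)) k \<longleftrightarrow> eigenvalue (Q_mat G vs) k" for k
    unfolding eigenvalue_Q_mat_iff[OF assms] by (rule eigenvalue_Q_mat_iff)
  then show ?thesis
    unfolding q_min_def spectrum_def by presburger
qed

end

theory Submission
  imports Defs "HOL-Analysis.Convex"
begin

text \<open>
  The reason is a variational one. The quadratic form of the signless Laplacian is
  \<open>f \<mapsto> \<Sum>\<^bsub>uv \<in> E\<^esub> (f u + f v)\<^sup>2\<close>, and on the \<open>\<plusminus>1\<close> vector of a vertex set \<open>X\<close> it takes the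
  value \<open>4 (W - cut X)\<close>. Hence a lower bound \<open>c\<close> of the Rayleigh quotient bounds the spectrum from
  below by \<open>c\<close> and every cut from above by \<open>W - c n / 4\<close>. If in addition some \<open>\<plusminus>1\<close> vector is an
  eigenvector for \<open>c\<close>, both bounds are attained and the graph is \<open>Q\<close>-exact
  (\<open>Q_exact_if_sign_eigenvector\<close>).

  For a join of \<open>r\<close>-regular graphs the constant is \<open>c = 2 r\<close>, and the eigenvector is \<open>1\<close> on the
  first part and \<open>-1\<close> on the second: the edges between the parts cancel, and each of the \<open>r\<close>
  remaining edges at a vertex contributes twice the sign of that vertex. What remains is the lower
  bound on the Rayleigh quotient (\<open>signless_form_join_ge\<close>). Let \<open>S\<^sub>i\<close> and \<open>N\<^sub>i\<close> be the sum and the sum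
  of squares of \<open>f\<close> over part \<open>i\<close>. By Cauchy-Schwarz, part \<open>i\<close> contributes at least
  \<open>2 r S\<^sub>i\<^sup>2 / n\<^sub>i\<close> to the form; the edges between the parts contribute exactly
  \<open>n\<^sub>2 N\<^sub>1 + n\<^sub>1 N\<^sub>2 + 2 S\<^sub>1 S\<^sub>2\<close>. After subtracting \<open>2 r (N\<^sub>1 + N\<^sub>2)\<close>, the coefficients of \<open>N\<^sub>1\<close> and \<open>N\<^sub>2\<close>
  are \<open>n\<^sub>2 - 2 r\<close> and \<open>n\<^sub>1 - 2 r\<close>. They are nonnegative by the assumption on the orders, so the estimate
  \<open>N\<^sub>i \<ge> S\<^sub>i\<^sup>2 / n\<^sub>i\<close> may be inserted, and the result is the square
  \<open>(n\<^sub>2 S\<^sub>1 + n\<^sub>1 S\<^sub>2)\<^sup>2 / (n\<^sub>1 n\<^sub>2)\<close>.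
\<close>

section \<open>The quadratic form of the signless Laplacian\<close>

definition signless_form :: "'a graph \<Rightarrow> ('a \<Rightarrow> real) \<Rightarrow> real" where
  "signless_form G f = (\<Sum>e\<in>edges G. (\<Sum>v\<in>e. f v)\<^sup>2)"

lemma simple_graph_edgeE:
  assumes "simple_graph G" and "e \<in> edges G"
  obtains u v where "e = {u, v}" "u \<noteq> v" "u \<in> verts G" "v \<in> verts G"
  using assms unfolding simple_graph_def by blast

lemma simple_graph_finite_verts: "simple_graph G \<Longrightarrow> finite (verts G)"
  by (simp add: simple_graph_def)

lemma simple_graph_edge_subset: "simple_graph G \<Longrightarrow> e \<in> edges G \<Longrightarrow> e \<subseteq> verts G"
  by (erule (1) simple_graph_edgeE) auto

lemma simple_graph_finite_edges:
  assumes "simple_graph G" shows "finite (edges G)"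
proof (rule finite_subset)
  show "edges G \<subseteq> Pow (verts G)" using simple_graph_edge_subset[OF assms] by blast
qed (use assms in \<open>simp add: simple_graph_def\<close>)

text \<open>
  Summing edge totals over the edges at \<open>u\<close> counts \<open>u\<close> once per incident edge and every neighbour once;
  so the left-hand side, which mentions no matrix, is the entry at \<open>u\<close> of \<open>Q(G) f\<close>.
\<close>

lemma sum_incident_edges:
  fixes f :: "'a \<Rightarrow> real"
  assumes G: "simple_graph G" and u: "u \<in> verts G"
  shows "(\<Sum>e | e \<in> edges G \<and> u \<in> e. \<Sum>v\<in>e. f v) =
    real (vertex_degree G u) * f u + (\<Sum>v\<in>verts G. (if {u, v} \<in> edges G then 1 else 0) * f v)"
proof -
  define N where "N = {v \<in> verts G. {u, v} \<in> edges G}"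
  have noloop: "v \<noteq> u" if "v \<in> N" for v
    using that G unfolding N_def by (auto elim!: simple_graph_edgeE simp: doubleton_eq_iff)
  have b: "bij_betw (\<lambda>v. {u, v}) N {e \<in> edges G. u \<in> e}"
  proof (rule bij_betw_imageI)
    show "inj_on (\<lambda>v. {u, v}) N" by (auto simp: inj_on_def doubleton_eq_iff)
    show "(\<lambda>v. {u, v}) ` N = {e \<in> edges G. u \<in> e}"
    proof (intro equalityI subsetI)
      fix e assume e: "e \<in> {e \<in> edges G. u \<in> e}"
      then obtain a b where "e = {a, b}" "a \<in> verts G" "b \<in> verts G"
        using simple_graph_edgeE[OF G] by blast
      with e show "e \<in> (\<lambda>v. {u, v}) ` N" by (auto simp: N_def insert_commute)
    qed (auto simp: N_def)
  qed
  have "(\<Sum>e | e \<in> edges G \<and> u \<in> e. \<Sum>v\<in>e. f v) = (\<Sum>w\<in>N. \<Sum>v\<in>{u, w}. f v)"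
    by (rule sum.reindex_bij_betw[OF b, symmetric])
  also have "\<dots> = (\<Sum>w\<in>N. f u + f w)"
  proof (rule sum.cong)
    fix w assume "w \<in> N"
    then have "w \<noteq> u" by (rule noloop)
    then show "(\<Sum>v\<in>{u, w}. f v) = f u + f w" by simp
  qed simp
  also have "\<dots> = real (card N) * f u + (\<Sum>w\<in>N. f w)"
    by (simp add: sum.distrib)
  also have "card N = vertex_degree G u"
    unfolding vertex_degree_def by (rule bij_betw_same_card[OF b])
  also have "(\<Sum>w\<in>N. f w) = (\<Sum>v\<in>verts G. if {u, v} \<in> edges G then f v else 0)"
    unfolding N_def by (rule sum.inter_filter) (rule simple_graph_finite_verts[OF G])
  also have "\<dots> = (\<Sum>v\<in>verts G. (if {u, v} \<in> edges G then 1 else 0) * f v)"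
    by (rule sum.cong) auto
  finally show ?thesis .
qed

lemma sum_edges_incidence_swap:
  fixes h :: "'a \<Rightarrow> 'a set \<Rightarrow> real"
  assumes G: "simple_graph G"
  shows "(\<Sum>e\<in>edges G. \<Sum>v\<in>e. h v e) = (\<Sum>v\<in>verts G. \<Sum>e | e \<in> edges G \<and> v \<in> e. h v e)"
proof -
  have "(\<Sum>e\<in>edges G. \<Sum>v\<in>e. h v e) = (\<Sum>e\<in>edges G. \<Sum>v | v \<in> verts G \<and> v \<in> e. h v e)"
    using simple_graph_edge_subset[OF G] by (intro sum.cong) auto
  also have "\<dots> = (\<Sum>v\<in>verts G. \<Sum>e | e \<in> edges G \<and> v \<in> e. h v e)"
    by (rule sum.swap_restrict)
      (rule simple_graph_finite_edges[OF G] simple_graph_finite_verts[OF G])+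
  finally show ?thesis .
qed

lemma signless_form_eq_sum_verts:
  assumes "simple_graph G"
  shows "signless_form G f =
    (\<Sum>v\<in>verts G. f v * (\<Sum>e | e \<in> edges G \<and> v \<in> e. \<Sum>w\<in>e. f w))"
  unfolding signless_form_def power2_eq_square sum_distrib_right
    sum_edges_incidence_swap[OF assms] sum_distrib_left[symmetric] ..

lemma eigenvalue_Q_mat_iff_edges:
  assumes G: "simple_graph G" and en: "enumerates vs G"
  shows "eigenvalue (Q_mat G vs) k \<longleftrightarrow>
    (\<exists>f. (\<exists>v\<in>verts G. f v \<noteq> 0) \<and>
      (\<forall>u\<in>verts G. (\<Sum>e | e \<in> edges G \<and> u \<in> e. \<Sum>v\<in>e. f v) = k * f u))"
  unfolding eigenvalue_Q_mat_iff[OF en] using sum_incident_edges[OF G] by simp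

section \<open>A criterion for exactness\<close>

text \<open>
  An edge total of the \<open>\<plusminus>1\<close> vector of \<open>X\<close> is \<open>0\<close> on an edge that \<open>X\<close> cuts and \<open>\<plusminus>2\<close> on any other.
\<close>

lemma signless_form_sign_vector:
  assumes G: "simple_graph G"
  shows "signless_form G (\<lambda>v. if v \<in> X then 1 else - 1) =
    4 * (real (card (edges G)) - real (card {e \<in> edges G. card (e \<inter> X) = 1}))"
proof -
  have fin: "finite (edges G)" by (rule simple_graph_finite_edges[OF G])
  have "(\<Sum>v\<in>e. if v \<in> X then 1 else - 1 :: real)\<^sup>2 = 4 - (if card (e \<inter> X) = 1 then 4 else 0)"
    if e: "e \<in> edges G" for e
  proof -
    obtain u v where uv: "e = {u, v}" "u \<noteq> v"
      using simple_graph_edgeE[OF G e] by blast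
    then show ?thesis by (cases "u \<in> X"; cases "v \<in> X") (auto simp: Int_insert_left)
  qed
  then have "signless_form G (\<lambda>v. if v \<in> X then 1 else - 1) =
      (\<Sum>e\<in>edges G. 4 - (if card (e \<inter> X) = 1 then 4 else 0))"
    unfolding signless_form_def by (intro sum.cong) auto
  also have "\<dots> = 4 * real (card (edges G)) - (\<Sum>e\<in>{e \<in> edges G. card (e \<inter> X) = 1}. 4)"
    using fin by (simp add: sum_subtractf flip: sum.inter_filter)
  finally show ?thesis by simp
qed

lemma spectrum_Q_mat_ge:
  assumes G: "simple_graph G" and en: "enumerates vs G"
    and bound: "\<And>f. c * (\<Sum>v\<in>verts G. (f v)\<^sup>2) \<le> signless_form G f"
    and k: "k \<in> spectrum (Q_mat G vs)"
  shows "c \<le> k"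
proof -
  from k obtain f where nz: "\<exists>v\<in>verts G. f v \<noteq> 0"
    and eig: "\<And>u. u \<in> verts G \<Longrightarrow> (\<Sum>e | e \<in> edges G \<and> u \<in> e. \<Sum>v\<in>e. f v) = k * f u"
    unfolding spectrum_def by (auto simp: eigenvalue_Q_mat_iff_edges[OF G en])
  have "signless_form G f = k * (\<Sum>v\<in>verts G. (f v)\<^sup>2)"
    unfolding signless_form_eq_sum_verts[OF G] sum_distrib_left[of k]
    by (rule sum.cong) (auto simp only: eig power2_eq_square mult.left_commute)
  with bound[of f] have "c * (\<Sum>v\<in>verts G. (f v)\<^sup>2) \<le> k * (\<Sum>v\<in>verts G. (f v)\<^sup>2)"
    by simp
  moreover have "(\<Sum>v\<in>verts G. (f v)\<^sup>2) > 0"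
    using nz simple_graph_finite_verts[OF G] by (auto intro: sum_pos2)
  ultimately show ?thesis by simp
qed

lemma Q_exact_if_sign_eigenvector:
  assumes G: "simple_graph G" and ne: "verts G \<noteq> {}" and X: "X \<subseteq> verts G"
    and bound: "\<And>f. c * (\<Sum>v\<in>verts G. (f v)\<^sup>2) \<le> signless_form G f"
    and eig: "\<And>u. u \<in> verts G \<Longrightarrow>
      (\<Sum>e | e \<in> edges G \<and> u \<in> e. \<Sum>v\<in>e. if v \<in> X then 1 else - 1) =
      c * (if u \<in> X then 1 else - 1)"
  shows "Q_exact G"
proof -
  define n where "n = real (card (verts G))"
  define W where "W = real (card (edges G))"
  define cut where "cut Y = card {e \<in> edges G. card (e \<inter> Y) = 1}" for Y
  have fin: "finite (verts G)" by (rule simple_graph_finite_verts[OF G])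
  have n: "n > 0" using fin ne by (simp add: n_def card_gt_0_iff)

  have cut_X: "4 * (W - real (cut X)) = c * n"
  proof -
    have "4 * (W - real (cut X)) = signless_form G (\<lambda>v. if v \<in> X then 1 else - 1)"
      unfolding W_def cut_def by (rule signless_form_sign_vector[OF G, symmetric])
    also have "\<dots> = (\<Sum>v\<in>verts G. c)"
      unfolding signless_form_eq_sum_verts[OF G] by (rule sum.cong) (auto simp: eig)
    finally show ?thesis by (simp add: n_def)
  qed
  have "cut Y \<le> cut X" for Y
  proof -
    have "c * n = c * (\<Sum>v\<in>verts G. (if v \<in> Y then 1 else - 1)\<^sup>2)"
      by (simp add: n_def if_distrib[of "\<lambda>x. x\<^sup>2"] cong: if_cong)
    also have "\<dots> \<le> 4 * (W - real (cut Y))"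
      using bound[of "\<lambda>v. if v \<in> Y then 1 else - 1"]
      unfolding W_def cut_def signless_form_sign_vector[OF G] .
    finally show ?thesis using cut_X by simp
  qed
  then have "mcut G = cut X"
    unfolding mcut_def cut_def[symmetric] using X fin by (intro Max_eqI) auto
  with cut_X n have rhs: "4 / n * (W - real (mcut G)) = c"
    by (simp add: field_simps)

  obtain vs where en: "enumerates vs G"
    using finite_distinct_list[OF fin] unfolding enumerates_def by blast
  have "Q_mat G vs \<in> carrier_mat (length vs) (length vs)"
    by (simp add: Q_mat_def degree_mat_def adjacency_mat_def)
  then have "finite (spectrum (Q_mat G vs))"
    by (rule card_finite_spectrum)
  moreover have "c \<in> spectrum (Q_mat G vs)"
    unfolding spectrum_def mem_Collect_eq eigenvalue_Q_mat_iff_edges[OF G en]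
    using eig ne by (intro exI[of _ "\<lambda>v. if v \<in> X then 1 else - 1"]) auto
  ultimately have "Min (spectrum (Q_mat G vs)) = c"
    using spectrum_Q_mat_ge[OF G en bound] by (intro Min_eqI) auto
  then show ?thesis
    using rhs unfolding Q_exact_def q_min_eq[OF en] graph_order_def n_def W_def by simp
qed

section \<open>Joins of regular graphs\<close>

lemma sum_edges_regular:
  fixes f :: "'a \<Rightarrow> real"
  assumes G: "simple_graph G" and r: "regular r G"
  shows "(\<Sum>e\<in>edges G. \<Sum>v\<in>e. f v) = real r * (\<Sum>v\<in>verts G. f v)"
proof -
  have "(\<Sum>e\<in>edges G. \<Sum>v\<in>e. f v) = (\<Sum>v\<in>verts G. real (vertex_degree G v) * f v)"
    unfolding sum_edges_incidence_swap[OF G] vertex_degree_def by simp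
  also have "\<dots> = real r * (\<Sum>v\<in>verts G. f v)"
    using r by (simp add: regular_def sum_distrib_left)
  finally show ?thesis .
qed

lemma card_edges_regular:
  assumes G: "simple_graph G" and r: "regular r G"
  shows "2 * real (card (edges G)) = real r * real (card (verts G))"
proof -
  have "card e = 2" if "e \<in> edges G" for e
    using simple_graph_edgeE[OF G that] by (metis card_2_iff)
  then have "2 * real (card (edges G)) = (\<Sum>e\<in>edges G. \<Sum>v\<in>e. 1)"
    by simp
  then show ?thesis by (simp only: sum_edges_regular[OF G r]) simp
qed

text \<open>
  The all-ones vector is an eigenvector of a regular graph for \<open>2 r\<close>, so this is the contribution of
  the mean of \<open>f\<close>. Cauchy-Schwarz over the \<open>r n / 2\<close> edges gives it at once, as the edge totals add up
  to \<open>r\<close> times the sum of \<open>f\<close>.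
\<close>

lemma signless_form_regular_ge:
  assumes G: "simple_graph G" and r: "regular r G"
  shows "2 * real r * (\<Sum>v\<in>verts G. f v)\<^sup>2 \<le> real (card (verts G)) * signless_form G f"
proof (cases "r = 0")
  case True
  then show ?thesis by (simp add: signless_form_def sum_nonneg)
next
  case False
  have "(real r * (\<Sum>v\<in>verts G. f v))\<^sup>2 \<le> signless_form G f * real (card (edges G))"
    unfolding sum_edges_regular[OF assms, symmetric] signless_form_def
    by (rule sum_squared_le_sum_of_squares)
  also have "\<dots> = real r * (real (card (verts G)) * signless_form G f / 2)"
    using card_edges_regular[OF assms] by (simp add: algebra_simps)
  finally have "real r * (real r * (\<Sum>v\<in>verts G. f v)\<^sup>2) \<le>
      real r * (real (card (verts G)) * signless_form G f / 2)"
    by (simp add: power2_eq_square algebra_simps)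
  then have "real r * (\<Sum>v\<in>verts G. f v)\<^sup>2 \<le> real (card (verts G)) * signless_form G f / 2"
    using False by simp
  then show ?thesis by simp
qed

lemma simple_graph_join:
  assumes "simple_graph H1" and "simple_graph H2" and "verts H1 \<inter> verts H2 = {}"
  shows "simple_graph (H1 \<nabla> H2)"
  unfolding simple_graph_def
proof
  show "finite (verts (H1 \<nabla> H2))"
    using assms by (simp add: graph_join_def simple_graph_def)
  have "\<exists>u v. e = {u, v} \<and> u \<in> verts (H1 \<nabla> H2) \<and> v \<in> verts (H1 \<nabla> H2) \<and> u \<noteq> v"
    if "e \<in> edges (H1 \<nabla> H2)" for e
  proof -
    from that consider "e \<in> edges H1" | "e \<in> edges H2"
      | u v where "e = {u, v}" "u \<in> verts H1" "v \<in> verts H2"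
      by (auto simp: graph_join_def)
    then show ?thesis
    proof cases
      case 1
      then obtain u v where "e = {u, v}" "u \<noteq> v" "u \<in> verts H1" "v \<in> verts H1"
        using simple_graph_edgeE[OF assms(1)] by blast
      then show ?thesis by (intro exI[of _ u] exI[of _ v]) (simp add: graph_join_def)
    next
      case 2
      then obtain u v where "e = {u, v}" "u \<noteq> v" "u \<in> verts H2" "v \<in> verts H2"
        using simple_graph_edgeE[OF assms(2)] by blast
      then show ?thesis by (intro exI[of _ u] exI[of _ v]) (simp add: graph_join_def)
    next
      case 3
      then have "u \<noteq> v" using assms(3) by blast
      with 3 show ?thesis by (intro exI[of _ u] exI[of _ v]) (simp add: graph_join_def)
    qed
  qed
  then show "edges (H1 \<nabla> H2) \<subseteq>
      {{u, v} |u v. u \<in> verts (H1 \<nabla> H2) \<and> v \<in> verts (H1 \<nabla> H2) \<and> u \<noteq> v}"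
    by blast
qed

lemma sum_edges_join:
  fixes h :: "'a set \<Rightarrow> real"
  assumes H1: "simple_graph H1" and H2: "simple_graph H2" and disj: "verts H1 \<inter> verts H2 = {}"
  shows "(\<Sum>e\<in>edges (H1 \<nabla> H2). h e) =
    (\<Sum>e\<in>edges H1. h e) + (\<Sum>e\<in>edges H2. h e) + (\<Sum>u\<in>verts H1. \<Sum>v\<in>verts H2. h {u, v})"
proof -
  define K where "K = (\<lambda>(u, v). {u, v}) ` (verts H1 \<times> verts H2)"
  have fin: "finite (edges H1)" "finite (edges H2)" "finite K"
    using simple_graph_finite_edges[OF H1] simple_graph_finite_edges[OF H2]
      simple_graph_finite_verts[OF H1] simple_graph_finite_verts[OF H2] by (auto simp: K_def)
  have d12: "edges H1 \<inter> edges H2 = {}"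
  proof (rule equals0I)
    fix e assume e: "e \<in> edges H1 \<inter> edges H2"
    then have "e \<subseteq> verts H1 \<inter> verts H2"
      using simple_graph_edge_subset[OF H1] simple_graph_edge_subset[OF H2] by simp
    moreover have "e \<noteq> {}" using e by (auto elim: simple_graph_edgeE[OF H2])
    ultimately show False using disj by simp
  qed
  have dK: "(edges H1 \<union> edges H2) \<inter> K = {}"
  proof (rule equals0I)
    fix e assume e: "e \<in> (edges H1 \<union> edges H2) \<inter> K"
    then obtain u v where uv: "e = {u, v}" "u \<in> verts H1" "v \<in> verts H2" by (auto simp: K_def)
    from e have "e \<subseteq> verts H1 \<or> e \<subseteq> verts H2"
      using simple_graph_edge_subset[OF H1] simple_graph_edge_subset[OF H2] by auto
    then show False using uv disj by auto
  qed
  have "inj_on (\<lambda>(u, v). {u, v}) (verts H1 \<times> verts H2)"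
    using disj by (auto simp: inj_on_def doubleton_eq_iff)
  then have "(\<Sum>e\<in>K. h e) = (\<Sum>(u, v)\<in>verts H1 \<times> verts H2. h {u, v})"
    unfolding K_def by (subst sum.reindex) (auto intro: sum.cong)
  then have "(\<Sum>e\<in>K. h e) = (\<Sum>u\<in>verts H1. \<Sum>v\<in>verts H2. h {u, v})"
    by (simp add: sum.cartesian_product)
  moreover have "edges (H1 \<nabla> H2) = edges H1 \<union> edges H2 \<union> K"
    by (auto simp: graph_join_def K_def)
  ultimately show ?thesis
    using fin d12 dK by (simp add: sum.union_disjoint)
qed

lemma signless_form_join:
  assumes H1: "simple_graph H1" and H2: "simple_graph H2" and disj: "verts H1 \<inter> verts H2 = {}"
  shows "signless_form (H1 \<nabla> H2) f = signless_form H1 f + signless_form H2 f +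
    real (card (verts H2)) * (\<Sum>u\<in>verts H1. (f u)\<^sup>2) +
    real (card (verts H1)) * (\<Sum>v\<in>verts H2. (f v)\<^sup>2) +
    2 * (\<Sum>u\<in>verts H1. f u) * (\<Sum>v\<in>verts H2. f v)"
proof -
  have "(\<Sum>u\<in>verts H1. \<Sum>v\<in>verts H2. (\<Sum>w\<in>{u, v}. f w)\<^sup>2) =
      (\<Sum>u\<in>verts H1. \<Sum>v\<in>verts H2. (f u)\<^sup>2 + (f v)\<^sup>2 + 2 * (f u * f v))"
  proof (intro sum.cong refl)
    fix u v assume "u \<in> verts H1" "v \<in> verts H2"
    then have "u \<noteq> v" using disj by blast
    then show "(\<Sum>w\<in>{u, v}. f w)\<^sup>2 = (f u)\<^sup>2 + (f v)\<^sup>2 + 2 * (f u * f v)"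
      by (simp add: power2_sum)
  qed
  also have "\<dots> = real (card (verts H2)) * (\<Sum>u\<in>verts H1. (f u)\<^sup>2) +
      real (card (verts H1)) * (\<Sum>v\<in>verts H2. (f v)\<^sup>2) +
      2 * ((\<Sum>u\<in>verts H1. f u) * (\<Sum>v\<in>verts H2. f v))"
    by (simp add: sum.distrib sum_product flip: sum_distrib_left)
  finally show ?thesis
    unfolding signless_form_def sum_edges_join[OF assms] by simp
qed

lemma signless_form_join_ge:
  fixes f :: "'a \<Rightarrow> real"
  assumes H1: "simple_graph H1" and H2: "simple_graph H2" and disj: "verts H1 \<inter> verts H2 = {}"
    and r1: "regular r H1" and r2: "regular r H2"
    and n1: "2 * r \<le> card (verts H1)" and n2: "2 * r \<le> card (verts H2)"
  shows "2 * real r * (\<Sum>v\<in>verts (H1 \<nabla> H2). (f v)\<^sup>2) \<le> signless_form (H1 \<nabla> H2) f"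
proof (cases "r = 0")
  \<comment> \<open>This case has to be separate because a part may then be empty.\<close>
  case True
  then show ?thesis by (simp add: signless_form_def sum_nonneg)
next
  case False
  define a b where "a = real (card (verts H1))" and "b = real (card (verts H2))"
  define S T where "S = (\<Sum>v\<in>verts H1. f v)" and "T = (\<Sum>v\<in>verts H2. f v)"
  define M N where "M = (\<Sum>v\<in>verts H1. (f v)\<^sup>2)" and "N = (\<Sum>v\<in>verts H2. (f v)\<^sup>2)"
  have pos: "a > 0" "b > 0" using False n1 n2 by (auto simp: a_def b_def)
  have ge: "2 * real r \<le> a" "2 * real r \<le> b" using n1 n2 by (auto simp: a_def b_def)
  have F1: "2 * real r * (S\<^sup>2 / a) \<le> signless_form H1 f"
    using signless_form_regular_ge[OF H1 r1, of f] pos by (simp add: a_def S_def field_simps)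
  have F2: "2 * real r * (T\<^sup>2 / b) \<le> signless_form H2 f"
    using signless_form_regular_ge[OF H2 r2, of f] pos by (simp add: b_def T_def field_simps)
  have "S\<^sup>2 \<le> M * a" "T\<^sup>2 \<le> N * b"
    unfolding S_def M_def a_def T_def N_def b_def by (rule sum_squared_le_sum_of_squares)+
  then have "S\<^sup>2 / a \<le> M" "T\<^sup>2 / b \<le> N" using pos by (simp_all add: field_simps)
  then have "(b - 2 * real r) * (S\<^sup>2 / a) + (a - 2 * real r) * (T\<^sup>2 / b) \<le>
      (b - 2 * real r) * M + (a - 2 * real r) * N"
    using ge by (intro add_mono mult_left_mono) auto
  moreover have "0 \<le> (b * S + a * T)\<^sup>2 / (a * b)" using pos by simp
  moreover have "(b * S + a * T)\<^sup>2 / (a * b) = b * (S\<^sup>2 / a) + a * (T\<^sup>2 / b) + 2 * S * T"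
    using pos by (simp add: field_simps power2_eq_square)
  ultimately have "2 * real r * (M + N) \<le>
      signless_form H1 f + signless_form H2 f + b * M + a * N + 2 * S * T"
    using F1 F2 by (simp add: algebra_simps)
  also have "\<dots> = signless_form (H1 \<nabla> H2) f"
    unfolding signless_form_join[OF H1 H2 disj] a_def b_def S_def T_def M_def N_def ..
  also have "M + N = (\<Sum>v\<in>verts (H1 \<nabla> H2). (f v)\<^sup>2)"
    using simple_graph_finite_verts[OF H1] simple_graph_finite_verts[OF H2] disj
    by (simp add: graph_join_def M_def N_def sum.union_disjoint)
  finally show ?thesis .
qed

lemma sign_eigenvector_join:
  assumes H1: "simple_graph H1" and H2: "simple_graph H2" and disj: "verts H1 \<inter> verts H2 = {}"
    and r1: "regular r H1" and r2: "regular r H2" and u: "u \<in> verts (H1 \<nabla> H2)"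
  defines "s \<equiv> \<lambda>v. if v \<in> verts H1 then 1 else - 1 :: real"
  shows "(\<Sum>e | e \<in> edges (H1 \<nabla> H2) \<and> u \<in> e. \<Sum>v\<in>e. s v) = 2 * real r * s u"
proof -
  have inside: "(\<Sum>e\<in>edges H. if u \<in> e then \<Sum>v\<in>e. s v else 0) =
      (if u \<in> verts H then 2 * real r * s u else 0)"
    if H: "simple_graph H" "regular r H" and const: "\<forall>v\<in>verts H. \<forall>w\<in>verts H. s v = s w" for H
  proof -
    have "(\<Sum>v\<in>e. s v) = 2 * s u" if e: "e \<in> edges H" "u \<in> e" for e
    proof -
      obtain v w where vw: "e = {v, w}" "v \<noteq> w" "v \<in> verts H" "w \<in> verts H"
        using simple_graph_edgeE[OF H(1) e(1)] by blast
      then have "u \<in> verts H" using e(2) by blast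
      then have "s v = s u" "s w = s u" using const vw by blast+
      then show ?thesis using vw by simp
    qed
    then have "(\<Sum>e\<in>edges H. if u \<in> e then \<Sum>v\<in>e. s v else 0) =
        (\<Sum>e\<in>edges H. if u \<in> e then 2 * s u else 0)"
      by (intro sum.cong) auto
    also have "\<dots> = 2 * real (vertex_degree H u) * s u"
      using simple_graph_finite_edges[OF H(1)]
      by (simp add: vertex_degree_def flip: sum.inter_filter)
    also have "\<dots> = (if u \<in> verts H then 2 * real r * s u else 0)"
    proof (cases "u \<in> verts H")
      case True
      then show ?thesis using H(2) by (simp add: regular_def)
    next
      case False
      then have "{e \<in> edges H. u \<in> e} = {}" using simple_graph_edge_subset[OF H(1)] by blast
      then show ?thesis using False by (simp only: vertex_degree_def) simp
    qed
    finally show ?thesis .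
  qed
  have between: "(\<Sum>w\<in>{x, y}. s w) = 0" if "x \<in> verts H1" "y \<in> verts H2" for x y
  proof -
    have "x \<noteq> y" "y \<notin> verts H1" using that disj by blast+
    then show ?thesis using that by (simp add: s_def)
  qed
  have "(\<Sum>e | e \<in> edges (H1 \<nabla> H2) \<and> u \<in> e. \<Sum>v\<in>e. s v) =
      (\<Sum>e\<in>edges (H1 \<nabla> H2). if u \<in> e then \<Sum>v\<in>e. s v else 0)"
    by (rule sum.inter_filter) (rule simple_graph_finite_edges[OF simple_graph_join[OF H1 H2 disj]])
  also have "\<dots> = (if u \<in> verts H1 then 2 * real r * s u else 0) +
      (if u \<in> verts H2 then 2 * real r * s u else 0) +
      (\<Sum>x\<in>verts H1. \<Sum>y\<in>verts H2. if u \<in> {x, y} then \<Sum>v\<in>{x, y}. s v else 0)"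
  proof -
    have "\<forall>v\<in>verts H1. \<forall>w\<in>verts H1. s v = s w" by (simp add: s_def)
    note first = inside[OF H1 r1 this]
    have "\<forall>v\<in>verts H2. \<forall>w\<in>verts H2. s v = s w" using disj by (auto simp: s_def)
    note second = inside[OF H2 r2 this]
    show ?thesis unfolding sum_edges_join[OF H1 H2 disj] first second ..
  qed
  also have "(\<Sum>x\<in>verts H1. \<Sum>y\<in>verts H2. if u \<in> {x, y} then \<Sum>v\<in>{x, y}. s v else 0) = 0"
    by (intro sum.neutral ballI) (simp only: between if_cancel)
  finally show ?thesis
    using u disj by (auto simp: graph_join_def)
qed

theorem proposition4p3:
  fixes H1 H2 G :: "'a graph" and r n1 n2 :: nat
  assumes "simple_graph H1" and "simple_graph H2"
    and "verts H1 \<inter> verts H2 = {}"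
    and "G = H1 \<nabla> H2" and "verts G \<noteq> {}"
    and "regular r H1" and "regular r H2"
    and "graph_order H1 = n1" and "graph_order H2 = n2"
    and "min n1 n2 \<ge> 2 * r"
  shows "Q_exact G"
proof (rule Q_exact_if_sign_eigenvector)
  show "simple_graph G" using simple_graph_join assms by blast
  show "verts H1 \<subseteq> verts G" using assms(4) by (simp add: graph_join_def)
  show "2 * real r * (\<Sum>v\<in>verts G. (f v)\<^sup>2) \<le> signless_form G f" for f
    unfolding assms(4)
    by (rule signless_form_join_ge) (use assms in \<open>auto simp: graph_order_def\<close>)
  show "(\<Sum>e | e \<in> edges G \<and> u \<in> e. \<Sum>v\<in>e. if v \<in> verts H1 then 1 else - 1) =
      2 * real r * (if u \<in> verts H1 then 1 else - 1)" if "u \<in> verts G" for u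
    using sign_eigenvector_join[OF assms(1-3,6,7)] that unfolding assms(4) .
qed fact

end
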